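(* Let $m,p$ be positive integers with $p\le m/3$. If $\pi$ is a randomized two-party communication protocol that computes $\mathsf{PART\text{-}COMP}_{m,p}$ with error probability at most $1/3$, then the length (number of bits communicated in the worst case) of $\pi$ is at least $p/100$.
   Context: The partial complement problem $\mathsf{PART\text{-}COMP}_{m,p}$ is the following two-party communication problem (a relation, not a function): Alice receives a set $x\subseteq\{1,\ldots,m\}$ with $|x|=p$; Bob receives no input and must output a set $y\subseteq\{1,\ldots,m\}$ with $|y|=m/2$ such that $x\cap y=\emptyset$. A randomized protocol computes it with error probability at most $1/3$ if for every input $x$, with probability at least $2/3$ over the protocol's randomness, Bob's output is a valid such $y$. *)

theory Defs
  imports "HOL-Probability.Probability"
begin

text \<open>
  Deterministic two-party protocol trees. The type \<open>'a\<close> (resp. \<open>'b\<close>) is the local view of Alice (resp. Bob).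
  At an inner node the owner sends the bit computed from that view, and the
  computation continues in the first subtree if the bit is \<open>False\<close>, in the second if it is \<open>True\<close>.
  At a leaf Bob produces the output, which may depend on his view and on the leaf, i.e. on the
  transcript; the output itself is not communicated.
\<close>

datatype ('a, 'b, 'c) protocol =
    Output "'b \<Rightarrow> 'c"
  | Alice "'a \<Rightarrow> bool" "('a, 'b, 'c) protocol" "('a, 'b, 'c) protocol"
  | Bob "'b \<Rightarrow> bool" "('a, 'b, 'c) protocol" "('a, 'b, 'c) protocol"

fun run :: "('a, 'b, 'c) protocol \<Rightarrow> 'a \<Rightarrow> 'b \<Rightarrow> 'c" where
  "run (Output g) a b = g b"
| "run (Alice f P0 P1) a b = (if f a then run P1 a b else run P0 a b)"
| "run (Bob f P0 P1) a b = (if f b then run P1 a b else run P0 a b)"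

fun bits_sent :: "('a, 'b, 'c) protocol \<Rightarrow> 'a \<Rightarrow> 'b \<Rightarrow> nat" where
  "bits_sent (Output g) a b = 0"
| "bits_sent (Alice f P0 P1) a b = Suc (if f a then bits_sent P1 a b else bits_sent P0 a b)"
| "bits_sent (Bob f P0 P1) a b = Suc (if f b then bits_sent P1 a b else bits_sent P0 a b)"

text \<open>
  Randomized protocols with both shared and private coins, drawn independently from arbitrary
  probability spaces. The whole tree may depend on the shared coins, so this includes public-coin
  protocols (distributions over deterministic protocols) as well as private-coin ones (take the
  shared coins to be trivial).
\<close>

record ('x, 'y, 'c, 'r, 'ra, 'rb) randomized_protocol =
  shared_coins :: "'r measure"
  alice_coins :: "'ra measure"
  bob_coins :: "'rb measure"
  tree :: "'r \<Rightarrow> ('x \<times> 'ra, 'y \<times> 'rb, 'c) protocol"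

definition is_randomized_protocol ::
  "('x, 'y, 'c, 'r, 'ra, 'rb) randomized_protocol \<Rightarrow> bool" where
  "is_randomized_protocol \<pi> \<longleftrightarrow>
     prob_space (shared_coins \<pi>) \<and> prob_space (alice_coins \<pi>) \<and> prob_space (bob_coins \<pi>)"

definition coins ::
  "('x, 'y, 'c, 'r, 'ra, 'rb) randomized_protocol \<Rightarrow> ('r \<times> 'ra \<times> 'rb) measure" where
  "coins \<pi> = shared_coins \<pi> \<Otimes>\<^sub>M (alice_coins \<pi> \<Otimes>\<^sub>M bob_coins \<pi>)"

definition protocol_output ::
  "('x, 'y, 'c, 'r, 'ra, 'rb) randomized_protocol \<Rightarrow> 'x \<Rightarrow> 'y \<Rightarrow> 'r \<times> 'ra \<times> 'rb \<Rightarrow> 'c" where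
  "protocol_output \<pi> x y = (\<lambda>(r, ra, rb). run (tree \<pi> r) (x, ra) (y, rb))"

definition communication ::
  "('x, 'y, 'c, 'r, 'ra, 'rb) randomized_protocol \<Rightarrow> 'x \<Rightarrow> 'y \<Rightarrow> 'r \<times> 'ra \<times> 'rb \<Rightarrow> nat" where
  "communication \<pi> x y = (\<lambda>(r, ra, rb). bits_sent (tree \<pi> r) (x, ra) (y, rb))"

record ('x, 'y, 'c) problem =
  alice_inputs :: "'x set"
  bob_inputs :: "'y set"
  correct :: "'x \<Rightarrow> 'y \<Rightarrow> 'c \<Rightarrow> bool"

definition computes_with_error ::
  "('x, 'y, 'c, 'r, 'ra, 'rb) randomized_protocol \<Rightarrow> ('x, 'y, 'c) problem \<Rightarrow> real \<Rightarrow> bool" where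
  "computes_with_error \<pi> Q \<epsilon> \<longleftrightarrow>
     (\<forall>x \<in> alice_inputs Q. \<forall>y \<in> bob_inputs Q.
        {\<omega> \<in> space (coins \<pi>). correct Q x y (protocol_output \<pi> x y \<omega>)} \<in> sets (coins \<pi>) \<and>
        measure (coins \<pi>) {\<omega> \<in> space (coins \<pi>). correct Q x y (protocol_output \<pi> x y \<omega>)} \<ge> 1 - \<epsilon>)"

text \<open>
  The worst case is over all inputs of the problem and all outcomes of the coins. It may be infinite,
  since the depth of the tree need not be bounded uniformly in the shared coins; a supremum in
  \<open>nat\<close> would then be meaningless.
\<close>

definition protocol_length ::
  "('x, 'y, 'c, 'r, 'ra, 'rb) randomized_protocol \<Rightarrow> ('x, 'y, 'c) problem \<Rightarrow> enat" where
  "protocol_length \<pi> Q =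
     (SUP x \<in> alice_inputs Q. SUP y \<in> bob_inputs Q. SUP \<omega> \<in> space (coins \<pi>).
        enat (communication \<pi> x y \<omega>))"

text \<open>
  Bob's trivial input is of type \<open>unit\<close>. The condition \<open>2 * card y = m\<close> says that \<open>y\<close> has exactly
  \<open>m / 2\<close> elements; for odd \<open>m\<close> no output is correct.
\<close>

definition PART_COMP :: "nat \<Rightarrow> nat \<Rightarrow> (nat set, unit, nat set) problem" where
  "PART_COMP m p =
     \<lparr>alice_inputs = {x. x \<subseteq> {1..m} \<and> card x = p},
      bob_inputs = UNIV,
      correct = (\<lambda>x _ y. y \<subseteq> {1..m} \<and> 2 * card y = m \<and> x \<inter> y = {})\<rparr>"

end

theory Submission
  imports Defs
begin

text \<open>
  Fix the coins. If at most \<open>c\<close> bits are sent, then Bob has at most \<open>2 ^ c\<close> different outputs as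
  Alice's input varies, and an output \<open>y\<close> is correct for only \<open>(m div 2) choose p \<le> (m choose p) / 2 ^ p\<close>
  inputs. Averaging over the coins, the sum over all inputs of the success probabilities is at most
  \<open>2 ^ c * (m choose p) / 2 ^ p\<close>, whereas it must be at least \<open>2 / 3 * (m choose p)\<close>.
  Hence \<open>c \<ge> p\<close>, which is stronger than the claim.
\<close>

text \<open>Induction on the tree. A node of Alice splits \<open>A\<close> by the bit sent, so the
  bounds for the two subtrees add up; a node of Bob does not split \<open>A\<close>, because his
  view \<open>b\<close> is fixed. \<open>A\<close> is generalised since it shrinks at Alice's
  nodes.\<close>

lemma card_outputs_le:
  assumes "\<forall>a\<in>A. bits_sent P a b \<le> c"
  shows "finite ((\<lambda>a. run P a b) ` A) \<and> card ((\<lambda>a. run P a b) ` A) \<le> 2 ^ c"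
  using assms
proof (induction P arbitrary: A c)
  case (Output g)
  have "card ((\<lambda>a. run (Output g) a b) ` A) \<le> card {g b}"
    by (rule card_mono) auto
  also have "\<dots> \<le> 2 ^ c" by simp
  finally show ?case by (simp add: image_constant_conv)
next
  case (Alice f P0 P1)
  show ?case
  proof (cases "A = {}")
    case False
    \<comment> \<open>Any element of \<open>A\<close> witnesses that the root itself costs one bit,
      so \<open>c\<close> is positive.\<close>
    then obtain d where c: "c = Suc d" using Alice.prems by (cases c) auto
    let ?A0 = "{a\<in>A. \<not> f a}" and ?A1 = "{a\<in>A. f a}"
    let ?R0 = "(\<lambda>a. run P0 a b) ` ?A0" and ?R1 = "(\<lambda>a. run P1 a b) ` ?A1"
    have R0: "finite ?R0 \<and> card ?R0 \<le> 2 ^ d"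
      using Alice.prems c by (intro Alice.IH(1)) auto
    have R1: "finite ?R1 \<and> card ?R1 \<le> 2 ^ d"
      using Alice.prems c by (intro Alice.IH(2)) auto
    have "(\<lambda>a. run (Alice f P0 P1) a b) ` A = ?R0 \<union> ?R1" by auto
    then show ?thesis using R0 R1 card_Un_le[of ?R0 ?R1] c by simp
  qed simp
next
  case (Bob f P0 P1)
  show ?case
  proof (cases "A = {}")
    case False
    then obtain d where c: "c = Suc d" using Bob.prems by (cases c) auto
    let ?Q = "if f b then P1 else P0"
    have "finite ((\<lambda>a. run ?Q a b) ` A) \<and> card ((\<lambda>a. run ?Q a b) ` A) \<le> 2 ^ d"
    proof (cases "f b")
      case True
      then show ?thesis using Bob.prems c Bob.IH(2)[of A d] by simp
    next
      case False
      then show ?thesis using Bob.prems c Bob.IH(1)[of A d] by simp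
    qed
    moreover have "(\<lambda>a. run (Bob f P0 P1) a b) ` A = (\<lambda>a. run ?Q a b) ` A"
      by simp
    ultimately show ?thesis using c by simp
  qed simp
qed

text \<open>Passing from \<open>p\<close> to \<open>Suc p\<close> multiplies the left side by
  \<open>2 * (k - p)\<close> and the right side by \<open>2 * k - p\<close>, up to the common
  divisor \<open>Suc p\<close>.\<close>

lemma binomial_mult_power2_le: "(k choose p) * 2 ^ p \<le> (2 * k) choose p"
proof (induction p)
  case (Suc p)
  \<comment> \<open>Division-free recursion in \<open>p\<close>; for \<open>p \<ge> n\<close> the
    truncated subtraction makes both sides 0.\<close>
  have absorb: "Suc p * (n choose Suc p) = (n choose p) * (n - p)" for n
    using binomial_absorb_comp[of n p] binomial_absorption[of p n] by (simp add: mult.commute)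
  have "Suc p * ((k choose Suc p) * 2 ^ Suc p) = (Suc p * (k choose Suc p)) * 2 ^ Suc p"
    by (rule mult.assoc[symmetric])
  also have "\<dots> = ((k choose p) * 2 ^ p) * (2 * (k - p))"
    by (simp only: absorb power_Suc mult_ac)
  also have "\<dots> \<le> ((2 * k) choose p) * (2 * k - p)"
    by (intro mult_le_mono Suc.IH) simp
  also have "\<dots> = Suc p * ((2 * k) choose Suc p)"
    using absorb[of "2 * k"] by simp
  finally show ?case by (simp only: Suc_mult_le_cancel1)
qed simp

text \<open>The inputs counted are the \<open>p\<close>-subsets of the complement of
  \<open>y\<close>, which has \<open>m - card y = card y\<close> elements.\<close>

lemma card_disjoint_half_le:
  assumes "y \<subseteq> {1..m}" "2 * card y = m"
  shows "card {x. x \<subseteq> {1..m} \<and> card x = p \<and> x \<inter> y = {}} * 2 ^ p \<le> m choose p"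
proof -
  have "{x. x \<subseteq> {1..m} \<and> card x = p \<and> x \<inter> y = {}} = {x. x \<subseteq> {1..m} - y \<and> card x = p}"
    by auto
  moreover have "card ({1..m} - y) = card y"
    using assms finite_subset[OF assms(1)] by (simp add: card_Diff_subset)
  ultimately have "card {x. x \<subseteq> {1..m} \<and> card x = p \<and> x \<inter> y = {}} = (card y) choose p"
    using assms by (simp add: n_subsets)
  then show ?thesis using binomial_mult_power2_le[of "card y" p] assms by simp
qed

text \<open>Linearity of expectation: the sum of the indicators at \<omega> counts the events that
  contain \<omega>.\<close>

lemma (in prob_space) sum_prob_le:
  fixes B :: real
  assumes "finite X" "\<And>x. x \<in> X \<Longrightarrow> E x \<in> events"
    and le: "\<And>\<omega>. \<omega> \<in> space M \<Longrightarrow> real (card {x\<in>X. \<omega> \<in> E x}) \<le> B"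
  shows "(\<Sum>x\<in>X. prob (E x)) \<le> B"
proof -
  have "(\<Sum>x\<in>X. prob (E x)) = expectation (\<lambda>\<omega>. \<Sum>x\<in>X. indicator (E x) \<omega>)"
    using assms(2) by (subst Bochner_Integration.integral_sum)
      (auto simp: less_top[symmetric])
  also have "\<dots> \<le> expectation (\<lambda>_. B)"
  proof (rule integral_mono)
    show "integrable M (\<lambda>\<omega>. \<Sum>x\<in>X. indicator (E x) \<omega> :: real)"
      using assms(2) by (auto simp: less_top[symmetric])
    show "(\<Sum>x\<in>X. indicator (E x) \<omega>) \<le> B" if "\<omega> \<in> space M" for \<omega>
      using le[OF that] assms(1) by (simp add: indicator_def sum.If_cases Int_def)
  qed simp
  also have "\<dots> = B" by (simp add: prob_space)
  finally show ?thesis .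
qed

lemma prob_space_coins:
  assumes "is_randomized_protocol \<pi>"
  shows "prob_space (coins \<pi>)"
  using assms unfolding is_randomized_protocol_def coins_def
  by (auto intro!: prob_space_pair)

text \<open>With the coins fixed, the correctly answered inputs are grouped by the output they
  produce: there are at most \<open>2 ^ c\<close> groups, each of size at most
  \<open>(m choose p) / 2 ^ p\<close>.\<close>

lemma card_correct_inputs_le:
  assumes "\<forall>x\<in>alice_inputs (PART_COMP m p). communication \<pi> x () \<omega> \<le> c"
  shows "card {x\<in>alice_inputs (PART_COMP m p). correct (PART_COMP m p) x () (protocol_output \<pi> x () \<omega>)} * 2 ^ p
    \<le> 2 ^ c * (m choose p)"
proof -
  let ?X = "alice_inputs (PART_COMP m p)"
  let ?Y = "protocol_output \<pi>"
  obtain r ra rb where \<omega>: "\<omega> = (r, ra, rb)" by (metis prod_cases3)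
  let ?O = "(\<lambda>x. ?Y x () \<omega>) ` ?X"
  let ?C = "\<lambda>y. {x\<in>?X. correct (PART_COMP m p) x () y}"
  \<comment> \<open>Alice's private coins become a fixed part of her view, and Bob's view is the
    constant \<open>((), rb)\<close>.\<close>
  have "?O = (\<lambda>a. run (tree \<pi> r) a ((), rb)) ` ((\<lambda>x. (x, ra)) ` ?X)"
    by (auto simp: \<omega> protocol_output_def)
  moreover have "\<forall>a\<in>(\<lambda>x. (x, ra)) ` ?X. bits_sent (tree \<pi> r) a ((), rb) \<le> c"
    using assms by (auto simp: \<omega> communication_def)
  ultimately have O: "finite ?O" "card ?O \<le> 2 ^ c"
    using card_outputs_le[of "(\<lambda>x. (x, ra)) ` ?X" "tree \<pi> r" "((), rb)" c] by simp_all
  have C: "card (?C y) * 2 ^ p \<le> m choose p" for y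
  proof (cases "y \<subseteq> {1..m} \<and> 2 * card y = m")
    case True
    then have "?C y = {x. x \<subseteq> {1..m} \<and> card x = p \<and> x \<inter> y = {}}"
      by (auto simp: PART_COMP_def)
    then show ?thesis using card_disjoint_half_le[of y m p] True by simp
  next
    \<comment> \<open>An output of the wrong shape is correct for no input; this covers every output
      when \<open>m\<close> is odd.\<close>
    case False
    then have "?C y = {}" by (auto simp: PART_COMP_def)
    then show ?thesis by (simp only: card.empty)
  qed
  have finX: "finite ?X" by (simp add: PART_COMP_def)
  have "card {x\<in>?X. correct (PART_COMP m p) x () (?Y x () \<omega>)} \<le> card (\<Union>y\<in>?O. ?C y)"
    using O finX by (intro card_mono) auto
  also have "\<dots> \<le> (\<Sum>y\<in>?O. card (?C y))"
    by (rule card_UN_le[OF O(1)])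
  finally have "card {x\<in>?X. correct (PART_COMP m p) x () (?Y x () \<omega>)} * 2 ^ p
      \<le> (\<Sum>y\<in>?O. card (?C y) * 2 ^ p)"
    by (simp flip: sum_distrib_right)
  also have "\<dots> \<le> card ?O * (m choose p)"
    using sum_bounded_above[of ?O "\<lambda>y. card (?C y) * 2 ^ p" "m choose p"] C by simp
  also have "\<dots> \<le> 2 ^ c * (m choose p)"
    using O(2) by (rule mult_le_mono1)
  finally show ?thesis .
qed

lemma PART_COMP_communication_ge:
  assumes "p \<le> m" "is_randomized_protocol \<pi>" "computes_with_error \<pi> (PART_COMP m p) (1 / 3)"
    and c: "\<And>x \<omega>. x \<in> alice_inputs (PART_COMP m p) \<Longrightarrow> \<omega> \<in> space (coins \<pi>) \<Longrightarrow>
      communication \<pi> x () \<omega> \<le> c"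
  shows "p \<le> c"
proof (rule ccontr)
  assume "\<not> p \<le> c"
  \<comment> \<open>The gap of one between \<open>c\<close> and \<open>p\<close> pushes the average
    success probability down to 1/2, below the required 2/3.\<close>
  then have "(2::real) ^ Suc c \<le> 2 ^ p" by (intro power_increasing) auto
  let ?X = "alice_inputs (PART_COMP m p)"
  let ?E = "\<lambda>x. {\<omega>\<in>space (coins \<pi>). correct (PART_COMP m p) x () (protocol_output \<pi> x () \<omega>)}"
  let ?N = "real (m choose p)"
  interpret prob_space "coins \<pi>" using assms(2) by (rule prob_space_coins)
  have finX: "finite ?X" and cardX: "card ?X = m choose p"
    by (simp_all add: PART_COMP_def n_subsets)
  have E: "?E x \<in> events" "prob (?E x) \<ge> 2 / 3" if "x \<in> ?X" for x
    using assms(3) that by (auto simp: computes_with_error_def PART_COMP_def)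
  have "?N * (2 / 3) \<le> (\<Sum>x\<in>?X. prob (?E x))"
    using sum_bounded_below[of ?X "2 / 3" "\<lambda>x. prob (?E x)"] E(2) cardX by simp
  also have "\<dots> \<le> 2 ^ c * ?N / 2 ^ p"
  proof (rule sum_prob_le[OF finX E(1)])
    fix \<omega> assume \<omega>: "\<omega> \<in> space (coins \<pi>)"
    let ?K = "{x\<in>?X. correct (PART_COMP m p) x () (protocol_output \<pi> x () \<omega>)}"
    have "card ?K * 2 ^ p \<le> 2 ^ c * (m choose p)"
      using c \<omega> by (intro card_correct_inputs_le) auto
    then have "real (card ?K * 2 ^ p) \<le> real (2 ^ c * (m choose p))"
      by (rule of_nat_mono)
    then show "real (card {x\<in>?X. \<omega> \<in> ?E x}) \<le> 2 ^ c * ?N / 2 ^ p"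
      using \<omega> by (simp add: pos_le_divide_eq)
  qed
  also have "\<dots> \<le> ?N * (1 / 2)"
    using mult_right_mono[OF \<open>(2::real) ^ Suc c \<le> 2 ^ p\<close>, of ?N] by (simp add: field_simps)
  \<comment> \<open>The contradiction needs a positive number of inputs, which
    \<open>p \<le> m\<close> provides.\<close>
  finally show False using zero_less_binomial[OF assms(1)] by simp
qed

theorem theorem22:
  fixes m p :: nat
    and \<pi> :: "(nat set, unit, nat set, 'r, 'ra, 'rb) randomized_protocol"
  assumes "0 < m" and "0 < p"
    and "real p \<le> real m / 3"
    and "is_randomized_protocol \<pi>"
    and "computes_with_error \<pi> (PART_COMP m p) (1 / 3)"
  shows "ereal_of_enat (protocol_length \<pi> (PART_COMP m p)) \<ge> ereal (real p / 100)"
proof (cases "protocol_length \<pi> (PART_COMP m p)")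
  \<comment> \<open>A finite length bounds the communication of every run; for infinite length the
    claim is immediate.\<close>
  case (enat c)
  have "communication \<pi> x () \<omega> \<le> c"
    if "x \<in> alice_inputs (PART_COMP m p)" "\<omega> \<in> space (coins \<pi>)" for x \<omega>
  proof -
    have "enat (communication \<pi> x () \<omega>) \<le> protocol_length \<pi> (PART_COMP m p)"
      unfolding protocol_length_def
      by (rule SUP_upper2[OF that(1)], rule SUP_upper2[of "()"], simp add: PART_COMP_def,
          rule SUP_upper[OF that(2)])
    then show ?thesis using enat by simp
  qed
  moreover have "p \<le> m" using assms(3) by simp
  ultimately have "p \<le> c"
    using PART_COMP_communication_ge assms(4,5) by blast
  then show ?thesis using enat by simp
qed simp

end
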